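(* For any graphs $G$ and $H$, $$\gamma_o(G\Box H)\ge \frac{1}{2}\max\{\gamma(G)\gamma_o(H),\ \gamma_o(G)\gamma(H)\}.$$ Moreover, if $G$ has an efficient dominating set, then $$\gamma_o(G\Box H)\ge \gamma(G)\gamma_o(H).$$
   Context: All graphs are finite and simple. For a graph with vertex set $V$, a vertex $v$ and $S\subseteq V$, let $\delta_S(v)=|N(v)\cap S|$ and $\overline{S}=V\setminus S$. A nonempty set $S\subseteq V$ is a global offensive alliance if $\delta_S(v)\ge \delta_{\overline{S}}(v)+1$ for every $v\in\overline{S}$; $\gamma_o(G)$ is the minimum cardinality of a global offensive alliance of $G$. A set $S$ is a dominating set if every vertex not in $S$ has a neighbor in $S$; $\gamma(G)$ is the minimum cardinality of a dominating set. An efficient dominating set of $G$ is a dominating set $\{u_1,\dots,u_{\gamma(G)}\}$ (of cardinality $\gamma(G)$) such that the closed neighborhoods $N[u_i]$, $N[u_j]$ are disjoint for all $i\neq j$. $G\Box H$ is the Cartesian product: vertex set $V(G)\times V(H)$, with $(a,b)\sim(c,d)$ iff ($a=c$ and $b\sim d$ in $H$) or ($a\sim c$ in $G$ and $b=d$). *)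

theory Defs
  imports Complex_Main "Graph_Theory.Pair_Digraph"
begin

text \<open>Finite simple graphs are the \<^locale>\<open>pair_graph\<close>s: an edge is represented by its two
  opposite arcs, so the neighbours of a vertex are exactly its out-neighbours.\<close>

definition nbrs :: "'a pair_pre_digraph \<Rightarrow> 'a \<Rightarrow> 'a set" where
  "nbrs G v = {w \<in> pverts G. (v, w) \<in> parcs G}"

definition closed_nbrs :: "'a pair_pre_digraph \<Rightarrow> 'a \<Rightarrow> 'a set" where
  "closed_nbrs G v = insert v (nbrs G v)"

definition deg_in :: "'a pair_pre_digraph \<Rightarrow> 'a set \<Rightarrow> 'a \<Rightarrow> nat" where
  "deg_in G S v = card (nbrs G v \<inter> S)"

definition global_offensive_alliance :: "'a pair_pre_digraph \<Rightarrow> 'a set \<Rightarrow> bool" where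
  "global_offensive_alliance G S \<longleftrightarrow>
     S \<subseteq> pverts G \<and> S \<noteq> {} \<and>
     (\<forall>v \<in> pverts G - S. deg_in G S v \<ge> deg_in G (pverts G - S) v + 1)"

definition global_offensive_alliance_number :: "'a pair_pre_digraph \<Rightarrow> nat" where
  "global_offensive_alliance_number G =
     (LEAST k. \<exists>S. global_offensive_alliance G S \<and> card S = k)"

definition dominating_set :: "'a pair_pre_digraph \<Rightarrow> 'a set \<Rightarrow> bool" where
  "dominating_set G S \<longleftrightarrow>
     S \<subseteq> pverts G \<and> (\<forall>v \<in> pverts G - S. nbrs G v \<inter> S \<noteq> {})"

definition domination_number :: "'a pair_pre_digraph \<Rightarrow> nat" where
  "domination_number G = (LEAST k. \<exists>S. dominating_set G S \<and> card S = k)"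

definition efficient_dominating_set :: "'a pair_pre_digraph \<Rightarrow> 'a set \<Rightarrow> bool" where
  "efficient_dominating_set G S \<longleftrightarrow>
     dominating_set G S \<and> card S = domination_number G \<and>
     (\<forall>u \<in> S. \<forall>v \<in> S. u \<noteq> v \<longrightarrow> closed_nbrs G u \<inter> closed_nbrs G v = {})"

definition cartesian_product ::
    "'a pair_pre_digraph \<Rightarrow> 'b pair_pre_digraph \<Rightarrow> ('a \<times> 'b) pair_pre_digraph"
    (infixr \<open>\<box>\<close> 70) where
  "G \<box> H =
     \<lparr> pverts = pverts G \<times> pverts H,
       parcs = {((a, b), (c, d)) | a b c d.
         a \<in> pverts G \<and> b \<in> pverts H \<and> c \<in> pverts G \<and> d \<in> pverts H \<and>
         (a = c \<and> (b, d) \<in> parcs H \<or> (a, c) \<in> parcs G \<and> b = d)} \<rparr>"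

lemma pair_graph_cartesian_product:
  assumes "pair_graph G" "pair_graph H"
  shows "pair_graph (G \<box> H)"
proof -
  interpret G: pair_graph G by fact
  interpret H: pair_graph H by fact
  have sym: "(a, c) \<in> parcs G \<Longrightarrow> (c, a) \<in> parcs G" "(b, d) \<in> parcs H \<Longrightarrow> (d, b) \<in> parcs H"
    for a c b d
    using G.pair_sym_arcs H.pair_sym_arcs by (auto simp: symmetric_def dest: symD)
  have irr: "(a, a) \<notin> parcs G" "(b, b) \<notin> parcs H" for a b
    using G.pair_no_loops H.pair_no_loops by fastforce+
  have fin: "finite (pverts G \<times> pverts H)"
    using G.pair_finite_verts H.pair_finite_verts by simp
  have "parcs (G \<box> H) \<subseteq> (pverts G \<times> pverts H) \<times> (pverts G \<times> pverts H)"
    by (auto simp: cartesian_product_def)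
  then have "finite (parcs (G \<box> H))"
    using fin by (meson finite_SigmaI finite_subset)
  then show ?thesis
    using fin sym irr
    by unfold_locales (auto simp: cartesian_product_def symmetric_def intro!: symI)
qed

lemma global_offensive_alliance_pverts:
  "pverts G \<noteq> {} \<Longrightarrow> global_offensive_alliance G (pverts G)"
  by (simp add: global_offensive_alliance_def)

lemma dominating_set_pverts: "dominating_set G (pverts G)"
  by (simp add: dominating_set_def)

end

theory Submission
  imports Defs
begin

text \<open>Let \<open>S\<close> be a global offensive alliance of \<open>G \<box> H\<close> and let \<open>D\<close> be a minimum dominating
  set of \<open>G\<close>. Split \<open>V(G)\<close> into cells \<open>P u \<subseteq> N[u]\<close>, \<open>u \<in> D\<close>, and let \<open>S\<^sub>u\<close> be the projection to \<open>H\<close> of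
  the part of \<open>S\<close> above \<open>P u\<close>; the sizes of the \<open>S\<^sub>u\<close> add up to at most \<open>|S|\<close>. Adding to \<open>S\<^sub>u\<close>
  the set \<open>X\<^sub>u\<close> of vertices at which it violates the alliance condition yields a global offensive
  alliance of \<open>H\<close>. If \<open>v \<in> X\<^sub>u\<close>, then every vertex of \<open>P u \<times> {v}\<close> must have a neighbour in
  \<open>S \<inter> (V(G) \<times> {v})\<close>. So for fixed \<open>v\<close>, replacing in \<open>D\<close> all \<open>u\<close> with \<open>v \<in> X\<^sub>u\<close> by the row of \<open>S\<close>
  at \<open>v\<close> again dominates \<open>G\<close>, and minimality of \<open>D\<close> shows that the row is at least as large as the
  set of those \<open>u\<close>. Hence the sizes of the \<open>X\<^sub>u\<close> add up to at most \<open>|S|\<close> as well. For an efficient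
  dominating set one takes \<open>P u = N[u]\<close>, and then all \<open>X\<^sub>u\<close> are empty.\<close>

section \<open>Extremal alliances and dominating sets\<close>

lemma global_offensive_alliance_number_le:
  "global_offensive_alliance G S \<Longrightarrow> global_offensive_alliance_number G \<le> card S"
  unfolding global_offensive_alliance_number_def by (rule Least_le) blast

lemma minimum_global_offensive_alliance:
  assumes "pverts G \<noteq> {}"
  obtains S where "global_offensive_alliance G S" "card S = global_offensive_alliance_number G"
proof -
  have "\<exists>k S. global_offensive_alliance G S \<and> card S = k"
    using global_offensive_alliance_pverts[OF assms] by blast
  from LeastI_ex[OF this] show ?thesis
    using that unfolding global_offensive_alliance_number_def by blast
qed

lemma domination_number_le: "dominating_set G S \<Longrightarrow> domination_number G \<le> card S"
  unfolding domination_number_def by (rule Least_le) blast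

lemma minimum_dominating_set:
  obtains S where "dominating_set G S" "card S = domination_number G"
proof -
  have "\<exists>k S. dominating_set G S \<and> card S = k"
    using dominating_set_pverts by blast
  from LeastI_ex[OF this] show ?thesis
    using that unfolding domination_number_def by blast
qed

section \<open>Degrees and the alliance condition in a single graph\<close>

lemma pair_graph_finite_pverts:
  assumes "pair_graph G"
  shows "finite (pverts G)"
proof -
  interpret pair_graph G by fact
  show ?thesis by (rule pair_finite_verts)
qed

lemma pair_graph_sym:
  assumes "pair_graph G" and "(x, y) \<in> parcs G"
  shows "(y, x) \<in> parcs G"
proof -
  interpret pair_graph G by fact
  show ?thesis using assms(2) by (rule arcs_symmetric)
qed

lemma finite_nbrs: "pair_graph G \<Longrightarrow> finite (nbrs G v)"
  by (simp add: nbrs_def pair_graph_finite_pverts)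

lemma deg_in_mono:
  assumes "pair_graph G" and "A \<subseteq> B"
  shows "deg_in G A v \<le> deg_in G B v"
  unfolding deg_in_def using assms by (intro card_mono) (auto simp: finite_nbrs)

lemma global_offensive_allianceI:
  assumes "pverts G \<noteq> {}" and "S \<subseteq> pverts G"
    and "\<And>v. v \<in> pverts G - S \<Longrightarrow> deg_in G (pverts G - S) v < deg_in G S v"
  shows "global_offensive_alliance G S"
proof -
  \<comment> \<open>The strict inequality at any vertex would read \<open>n < 0\<close> if
    \<open>S\<close> were empty.\<close>
  have "S \<noteq> {}"
    using assms(1,3) by (fastforce simp: deg_in_def)
  then show ?thesis
    using assms(2,3) by (auto simp: global_offensive_alliance_def Suc_le_eq)
qed

text \<open>Enlarging a set raises degrees into it and lowers degrees into its complement, so a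
  vertex satisfied by \<open>S\<close> stays satisfied.\<close>

lemma global_offensive_alliance_add_violating:
  assumes G: "pair_graph G" and "pverts G \<noteq> {}" and "S \<subseteq> pverts G"
  shows "global_offensive_alliance G
    (S \<union> {v \<in> pverts G. deg_in G S v \<le> deg_in G (pverts G - S) v})"
    (is "global_offensive_alliance G (S \<union> ?X)")
proof (rule global_offensive_allianceI)
  fix v assume "v \<in> pverts G - (S \<union> ?X)"
  then have "deg_in G (pverts G - S) v < deg_in G S v" by auto
  moreover have "deg_in G (pverts G - (S \<union> ?X)) v \<le> deg_in G (pverts G - S) v"
    by (rule deg_in_mono[OF G]) auto
  moreover have "deg_in G S v \<le> deg_in G (S \<union> ?X) v"
    by (rule deg_in_mono[OF G]) auto
  ultimately show "deg_in G (pverts G - (S \<union> ?X)) v < deg_in G (S \<union> ?X) v"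
    by linarith
qed (use assms in auto)

section \<open>Neighbourhoods and symmetry of the product\<close>

lemma pverts_cartesian_product: "pverts (G \<box> H) = pverts G \<times> pverts H"
  by (simp add: cartesian_product_def)

lemma nbrs_cartesian_product:
  assumes "a \<in> pverts G" "b \<in> pverts H"
  shows "nbrs (G \<box> H) (a, b) = {a} \<times> nbrs H b \<union> nbrs G a \<times> {b}"
  using assms by (auto simp: nbrs_def cartesian_product_def)

text \<open>Exchanging the factors is an isomorphism of the products, so degrees are preserved; this
  makes the bound for one factor order yield the other.\<close>

lemma global_offensive_alliance_swap:
  assumes "global_offensive_alliance (G \<box> H) S"
  shows "global_offensive_alliance (H \<box> G) (prod.swap ` S)"
proof -
  have S: "S \<subseteq> pverts G \<times> pverts H" "S \<noteq> {}"
    using assms by (auto simp: global_offensive_alliance_def pverts_cartesian_product)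
  have deg: "deg_in (H \<box> G) (prod.swap ` T) (b, a) = deg_in (G \<box> H) T (a, b)"
    if "a \<in> pverts G" "b \<in> pverts H" for a b T
  proof -
    have "nbrs (H \<box> G) (b, a) \<inter> prod.swap ` T = prod.swap ` (nbrs (G \<box> H) (a, b) \<inter> T)"
      using that by (auto simp: nbrs_cartesian_product image_iff)
    then show ?thesis
      by (simp add: deg_in_def card_image)
  qed
  have compl: "pverts (H \<box> G) - prod.swap ` S = prod.swap ` (pverts (G \<box> H) - S)"
    by (force simp: pverts_cartesian_product image_iff)
  show ?thesis
    using assms S unfolding global_offensive_alliance_def compl
    by (auto simp: deg pverts_cartesian_product)
qed

lemma global_offensive_alliance_number_cartesian_product_commute_le:
  assumes "pverts G \<noteq> {}" "pverts H \<noteq> {}"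
  shows "global_offensive_alliance_number (H \<box> G) \<le> global_offensive_alliance_number (G \<box> H)"
proof -
  have "pverts (G \<box> H) \<noteq> {}"
    using assms by (simp add: pverts_cartesian_product)
  then obtain S where S: "global_offensive_alliance (G \<box> H) S"
    "card S = global_offensive_alliance_number (G \<box> H)"
    by (rule minimum_global_offensive_alliance)
  show ?thesis
    using global_offensive_alliance_number_le[OF global_offensive_alliance_swap[OF S(1)]] S(2)
    by (simp add: card_image)
qed

section \<open>Fibres, cells and rows of an alliance in the product\<close>

text \<open>By \<open>no_nbr\<close>, all neighbours of \<open>(x, v)\<close> in \<open>S\<close>
  lie in the fibre over \<open>x\<close>, hence come from neighbours of \<open>v\<close> in
  \<open>T\<close>, while a neighbour of \<open>v\<close> outside \<open>T\<close> lifts to a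
  neighbour of \<open>(x, v)\<close> outside \<open>S\<close>. \<open>T\<close> need only contain
  the projection of this fibre, so it may be the projection of a whole cell.\<close>

lemma fiber_alliance_condition:
  assumes G: "pair_graph G" and H: "pair_graph H"
    and S: "global_offensive_alliance (G \<box> H) S"
    and x: "x \<in> pverts G" and v: "v \<in> pverts H" and "(x, v) \<notin> S"
    and no_nbr: "\<And>y. y \<in> nbrs G x \<Longrightarrow> (y, v) \<notin> S"
    and T: "\<And>w. (x, w) \<in> S \<Longrightarrow> w \<in> T"
  shows "deg_in H (pverts H - T) v < deg_in H T v"
proof -
  have fin: "finite (nbrs (G \<box> H) (x, v))"
    by (rule finite_nbrs[OF pair_graph_cartesian_product[OF G H]])
  have "deg_in H (pverts H - T) v = card (Pair x ` (nbrs H v \<inter> (pverts H - T)))"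
    by (simp add: deg_in_def card_image inj_on_def)
  also have "\<dots> \<le> deg_in (G \<box> H) (pverts (G \<box> H) - S) (x, v)"
    unfolding deg_in_def using fin x v T
    by (intro card_mono) (auto simp: nbrs_cartesian_product pverts_cartesian_product)
  also have "\<dots> < deg_in (G \<box> H) S (x, v)"
    using assms by (auto simp: global_offensive_alliance_def pverts_cartesian_product Suc_le_eq)
  also have "\<dots> \<le> card (Pair x ` (nbrs H v \<inter> T))"
    unfolding deg_in_def using finite_nbrs[OF H] x v T no_nbr
    by (intro card_mono) (auto simp: nbrs_cartesian_product)
  also have "\<dots> = deg_in H T v"
    by (simp add: deg_in_def card_image inj_on_def)
  finally show ?thesis .
qed

lemma sum_card_projections_le:
  assumes "finite S" "finite D"
    and disj: "\<And>u u'. \<lbrakk>u \<in> D; u' \<in> D; u \<noteq> u'\<rbrakk> \<Longrightarrow> P u \<inter> P u' = {}"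
  shows "(\<Sum>u\<in>D. card (snd ` (S \<inter> P u \<times> UNIV))) \<le> card S"
proof -
  have "(\<Sum>u\<in>D. card (snd ` (S \<inter> P u \<times> UNIV))) \<le> (\<Sum>u\<in>D. card (S \<inter> P u \<times> UNIV))"
    using assms(1) by (intro sum_mono card_image_le) auto
  also have "\<dots> = card (\<Union>u\<in>D. S \<inter> P u \<times> UNIV)"
    using assms(1,2) disj by (intro card_UN_disjoint[symmetric]) blast+
  also have "\<dots> \<le> card S"
    using assms(1) by (intro card_mono) auto
  finally show ?thesis .
qed

lemma card_eq_sum_rows:
  assumes "S \<subseteq> A \<times> B" "finite A" "finite B"
  shows "card S = (\<Sum>v\<in>B. card {x. (x, v) \<in> S})"
proof -
  have rows: "finite {x. (x, v) \<in> S}" for v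
    by (rule finite_subset[OF _ assms(2)]) (use assms(1) in auto)
  \<comment> \<open>Swapping puts the row index first, which exhibits \<open>S\<close> as a disjoint
    union of rows.\<close>
  have "prod.swap ` S = (SIGMA v:B. {x. (x, v) \<in> S})"
    using assms(1) by (force simp: image_iff)
  moreover have "card (prod.swap ` S) = card S"
    by (simp add: card_image)
  ultimately show ?thesis
    using assms(3) rows by (simp add: card_SigmaI)
qed

text \<open>\<open>R\<close> takes over the vertices that \<open>f\<close> assigns to
  \<open>B\<close>, and all others keep their dominator in \<open>D - B\<close>. So
  \<open>R \<union> (D - B)\<close> dominates, and by minimality it is no smaller than
  \<open>D\<close>.\<close>

lemma domination_number_exchange:
  assumes "dominating_set G D" and D: "card D = domination_number G" "finite D"
    and "B \<subseteq> D" and "R \<subseteq> pverts G" "finite R"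
    and f: "\<And>x. x \<in> pverts G \<Longrightarrow> f x \<in> D \<and> x \<in> closed_nbrs G (f x)"
    and dom: "\<And>x. \<lbrakk>x \<in> pverts G; f x \<in> B; x \<notin> R\<rbrakk> \<Longrightarrow> nbrs G x \<inter> R \<noteq> {}"
    and sym: "\<And>x y. (x, y) \<in> parcs G \<Longrightarrow> (y, x) \<in> parcs G"
  shows "card B \<le> card R"
proof -
  have DV: "D \<subseteq> pverts G" using assms(1) by (simp add: dominating_set_def)
  have "dominating_set G (R \<union> (D - B))"
    unfolding dominating_set_def
  proof (intro conjI ballI)
    show "R \<union> (D - B) \<subseteq> pverts G" using assms DV by auto
    fix x assume x: "x \<in> pverts G - (R \<union> (D - B))"
    show "nbrs G x \<inter> (R \<union> (D - B)) \<noteq> {}"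
    proof (cases "f x \<in> B")
      case True
      then show ?thesis using dom x by blast
    next
      case False
      \<comment> \<open>Since \<open>x\<close> lies outside \<open>D - B\<close>, it differs from
        \<open>f x\<close>, so membership in the closed neighbourhood is a genuine
        adjacency.\<close>
      then have "f x \<in> D - B" "x \<noteq> f x" "f x \<in> nbrs G x"
        using f[of x] x DV sym by (auto simp: closed_nbrs_def nbrs_def)
      then show ?thesis by blast
    qed
  qed
  then have "card D \<le> card (R \<union> (D - B))"
    using domination_number_le D by metis
  also have "\<dots> \<le> card R + card (D - B)" by (rule card_Un_le)
  also have "card (D - B) = card D - card B"
    using assms by (intro card_Diff_subset) (auto intro: finite_subset)
  finally show ?thesis
    using card_mono[OF D(2) \<open>B \<subseteq> D\<close>] by linarith
qed

section \<open>The lower bounds\<close>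

lemma domination_alliance_product_le_twice:
  assumes G: "pair_graph G" and GV: "pverts G \<noteq> {}"
    and H: "pair_graph H" and HV: "pverts H \<noteq> {}"
  shows "domination_number G * global_offensive_alliance_number H
    \<le> 2 * global_offensive_alliance_number (G \<box> H)"
proof -
  have finG: "finite (pverts G)" and finH: "finite (pverts H)"
    using G H by (simp_all add: pair_graph_finite_pverts)
  have "pverts (G \<box> H) \<noteq> {}"
    using GV HV by (simp add: pverts_cartesian_product)
  then obtain S where S: "global_offensive_alliance (G \<box> H) S"
    and cardS: "card S = global_offensive_alliance_number (G \<box> H)"
    by (rule minimum_global_offensive_alliance)
  have SV: "S \<subseteq> pverts G \<times> pverts H"
    using S by (simp add: global_offensive_alliance_def pverts_cartesian_product)
  have finS: "finite S" using SV finG finH by (meson finite_SigmaI finite_subset)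
  obtain D where D: "dominating_set G D" and cardD: "card D = domination_number G"
    by (rule minimum_dominating_set)
  have finD: "finite D" and DV: "D \<subseteq> pverts G"
    using D finG by (auto simp: dominating_set_def intro: finite_subset)
  have "\<exists>u. u \<in> D \<and> x \<in> closed_nbrs G u" if x: "x \<in> pverts G" for x
  proof (cases "x \<in> D")
    case False
    then obtain u where "u \<in> nbrs G x" "u \<in> D"
      using D x unfolding dominating_set_def by blast
    then show ?thesis
      using pair_graph_sym[OF G] x by (auto simp: closed_nbrs_def nbrs_def)
  qed (auto simp: closed_nbrs_def)
  then obtain f where f: "\<And>x. x \<in> pverts G \<Longrightarrow> f x \<in> D \<and> x \<in> closed_nbrs G (f x)"
    by metis
  \<comment> \<open>Closed neighbourhoods may overlap; the preimages under the choice
    \<open>f\<close> are disjoint, and \<open>P u\<close> still lies in the closed neighbourhood of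
    \<open>u\<close>.\<close>
  define P where "P u = {x \<in> pverts G. f x = u}" for u
  define T where "T u = snd ` (S \<inter> P u \<times> UNIV)" for u
  define X where "X u = {v \<in> pverts H. deg_in H (T u) v \<le> deg_in H (pverts H - T u) v}" for u
  \<comment> \<open>Members of \<open>T u\<close> are exempt from the alliance condition, so only
    violations outside \<open>T u\<close> are counted.\<close>
  define X' where "X' u = X u - T u" for u
  have TH: "T u \<subseteq> pverts H" for u
    using SV by (auto simp: T_def)
  have row: "card {u \<in> D. v \<in> X' u} \<le> card {x. (x, v) \<in> S}" if v: "v \<in> pverts H" for v
  proof (rule domination_number_exchange[OF D cardD finD _ _ _ f])
    show "{x. (x, v) \<in> S} \<subseteq> pverts G" using SV by auto
    then show "finite {x. (x, v) \<in> S}" using finG finite_subset by blast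
    fix x assume x: "x \<in> pverts G" "f x \<in> {u \<in> D. v \<in> X' u}" "x \<notin> {x. (x, v) \<in> S}"
    show "nbrs G x \<inter> {x. (x, v) \<in> S} \<noteq> {}"
    proof
      \<comment> \<open>Then the fibre over \<open>x\<close> alone would satisfy the condition for
        \<open>T (f x)\<close> at \<open>v\<close>, against \<open>v \<in> X' (f x)\<close>.\<close>
      assume "nbrs G x \<inter> {x. (x, v) \<in> S} = {}"
      then have "deg_in H (pverts H - T (f x)) v < deg_in H (T (f x)) v"
        using x v
        by (intro fiber_alliance_condition[OF G H S x(1) v]) (force simp: T_def P_def)+
      then show False using x(2) by (simp add: X'_def X_def)
    qed
  qed (use pair_graph_sym[OF G] in auto)
  have "domination_number G * global_offensive_alliance_number H
      = (\<Sum>u\<in>D. global_offensive_alliance_number H)"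
    by (simp add: cardD)
  also have "\<dots> \<le> (\<Sum>u\<in>D. card (T u) + card (X' u))"
  proof (rule sum_mono)
    fix u
    have "global_offensive_alliance_number H \<le> card (T u \<union> X u)"
      unfolding X_def
      by (intro global_offensive_alliance_number_le
          global_offensive_alliance_add_violating[OF H HV TH])
    also have "T u \<union> X u = T u \<union> X' u" by (auto simp: X'_def)
    also have "card (T u \<union> X' u) \<le> card (T u) + card (X' u)" by (rule card_Un_le)
    finally show "global_offensive_alliance_number H \<le> card (T u) + card (X' u)" .
  qed
  also have "\<dots> = (\<Sum>u\<in>D. card (T u)) + (\<Sum>u\<in>D. card (X' u))"
    by (rule sum.distrib)
  also have "(\<Sum>u\<in>D. card (T u)) \<le> card S"
    unfolding T_def by (rule sum_card_projections_le[OF finS finD]) (auto simp: P_def)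
  also have "(\<Sum>u\<in>D. card (X' u)) \<le> card S"
  proof -
    \<comment> \<open>Double counting of the pairs \<open>(u, v)\<close> with
      \<open>v \<in> X' u\<close>.\<close>
    have "(\<Sum>u\<in>D. card (X' u)) = (\<Sum>u\<in>D. \<Sum>v | v \<in> pverts H \<and> v \<in> X' u. 1)"
      by (intro sum.cong) (auto simp: X'_def X_def intro!: arg_cong[where f = card])
    also have "\<dots> = (\<Sum>v\<in>pverts H. \<Sum>u | u \<in> D \<and> v \<in> X' u. 1)"
      by (rule sum.swap_restrict[OF finD finH])
    also have "\<dots> \<le> (\<Sum>v\<in>pverts H. card {x. (x, v) \<in> S})"
      using row by (intro sum_mono) simp
    also have "\<dots> = card S"
      by (rule card_eq_sum_rows[OF SV finG finH, symmetric])
    finally show ?thesis .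
  qed
  finally show ?thesis using cardS by simp
qed

text \<open>The closed neighbourhoods are disjoint and can themselves be the cells. Each contains
  all neighbours of its centre \<open>u\<close>, so for \<open>v\<close> outside \<open>T u\<close>
  the fibre condition applies at \<open>(u, v)\<close> and no vertices need to be added.\<close>

lemma efficient_domination_alliance_product_le:
  assumes G: "pair_graph G" and GV: "pverts G \<noteq> {}"
    and H: "pair_graph H" and HV: "pverts H \<noteq> {}"
    and eff: "efficient_dominating_set G D"
  shows "domination_number G * global_offensive_alliance_number H
    \<le> global_offensive_alliance_number (G \<box> H)"
proof -
  have finG: "finite (pverts G)" and finH: "finite (pverts H)"
    using G H by (simp_all add: pair_graph_finite_pverts)
  have "pverts (G \<box> H) \<noteq> {}"
    using GV HV by (simp add: pverts_cartesian_product)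
  then obtain S where S: "global_offensive_alliance (G \<box> H) S"
    and cardS: "card S = global_offensive_alliance_number (G \<box> H)"
    by (rule minimum_global_offensive_alliance)
  have SV: "S \<subseteq> pverts G \<times> pverts H"
    using S by (simp add: global_offensive_alliance_def pverts_cartesian_product)
  have finS: "finite S" using SV finG finH by (meson finite_SigmaI finite_subset)
  have cardD: "card D = domination_number G" and DV: "D \<subseteq> pverts G"
    and disj: "\<And>u u'. \<lbrakk>u \<in> D; u' \<in> D; u \<noteq> u'\<rbrakk> \<Longrightarrow> closed_nbrs G u \<inter> closed_nbrs G u' = {}"
    using eff by (auto simp: efficient_dominating_set_def dominating_set_def)
  have finD: "finite D" using DV finG finite_subset by blast
  define T where "T u = snd ` (S \<inter> closed_nbrs G u \<times> UNIV)" for u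
  have alliance: "global_offensive_alliance H (T u)" if u: "u \<in> D" for u
  proof (rule global_offensive_allianceI[OF HV])
    show "T u \<subseteq> pverts H" using SV by (auto simp: T_def)
    fix v assume v: "v \<in> pverts H - T u"
    then have "(x, v) \<notin> S" if "x \<in> closed_nbrs G u" for x
      using that by (force simp: T_def)
    then show "deg_in H (pverts H - T u) v < deg_in H (T u) v"
      using u v DV
      by (intro fiber_alliance_condition[OF G H S, of u v]) (force simp: T_def closed_nbrs_def)+
  qed
  have "domination_number G * global_offensive_alliance_number H
      = (\<Sum>u\<in>D. global_offensive_alliance_number H)"
    by (simp add: cardD)
  also have "\<dots> \<le> (\<Sum>u\<in>D. card (T u))"
    by (intro sum_mono global_offensive_alliance_number_le alliance)
  also have "\<dots> \<le> card S"
    unfolding T_def by (rule sum_card_projections_le[OF finS finD disj])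
  finally show ?thesis using cardS by simp
qed

theorem theorem2:
  fixes G :: "'a pair_pre_digraph" and H :: "'b pair_pre_digraph"
  assumes "pair_graph G" and "pverts G \<noteq> {}"
    and "pair_graph H" and "pverts H \<noteq> {}"
  shows "real (global_offensive_alliance_number (G \<box> H)) \<ge>
           1 / 2 * max (real (domination_number G) * real (global_offensive_alliance_number H))
                       (real (global_offensive_alliance_number G) * real (domination_number H))
       \<and> ((\<exists>S. efficient_dominating_set G S) \<longrightarrow>
           global_offensive_alliance_number (G \<box> H) \<ge>
             domination_number G * global_offensive_alliance_number H)"
proof -
  let ?n = "global_offensive_alliance_number (G \<box> H)"
  have "domination_number G * global_offensive_alliance_number H \<le> 2 * ?n"
    by (rule domination_alliance_product_le_twice[OF assms])
  then have 1: "real (domination_number G) * real (global_offensive_alliance_number H)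
      \<le> 2 * real ?n"
    by (metis of_nat_le_iff of_nat_mult of_nat_numeral)
  \<comment> \<open>The first bound with the factors exchanged, carried back to
    \<open>G \<box> H\<close> by the swap.\<close>
  have "global_offensive_alliance_number G * domination_number H \<le> 2 * ?n"
    using domination_alliance_product_le_twice[OF assms(3,4,1,2)]
      global_offensive_alliance_number_cartesian_product_commute_le[OF assms(2,4)]
    by (simp add: mult.commute)
  then have 2: "real (global_offensive_alliance_number G) * real (domination_number H)
      \<le> 2 * real ?n"
    by (metis of_nat_le_iff of_nat_mult of_nat_numeral)
  show ?thesis
    using 1 2 efficient_domination_alliance_product_le[OF assms] by auto
qed

end
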